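(* Let $n\ge 1$ and $r\ge 1$ be integers. Let $\alpha\in\mathbb{N}_1^n$, let $m=m_1(\alpha)$, and suppose that $|\alpha|'=r-k$ for some $k\in\{0,1,\ldots,n+m-1\}$. If $m<n$, then $$c_\alpha=c_{m,k}:=\sum_{i=0}^{m}(-1)^{k+i}\binom{m}{i}\binom{n-m-1}{k-2i},$$ with the convention that $\binom{l}{j}=0$ if $j<0$ or $j>l$.
   Context: $\mathbb{N}_0=\{0,1,2,\ldots\}$ and $\mathbb{N}_1=\{1,2,3,\ldots\}$. For $\alpha=(\alpha_1,\ldots,\alpha_n)\in\mathbb{N}_0^n$, $|\alpha|=\sum_{j=1}^n\alpha_j$, the superlinear norm is $|\alpha|'=\sum_{j:\,\alpha_j\ge 2}\alpha_j$ (sum over those $j$ with $\alpha_j\ge2$; $0$ if there are none), and $m_1(\alpha)=\#\{j:\alpha_j=1\}$. Define $S_r=\{\alpha\in\mathbb{N}_0^n:|\alpha|'\le r\}$ and let $\chi(S_r):\mathbb{N}_0^n\to\{0,1\}$ be its characteristic function ($1$ on $S_r$, $0$ elsewhere). For $\alpha\in S_r$ define the integer $$c_\alpha=\sum_{\epsilon\in\{0,1\}^n}(-1)^{|\epsilon|}\,\chi(S_r)(\alpha+\epsilon).$$ (These are the coefficients expressing the interpolant on the lower set $S_r$ as a linear combination of tensor-product interpolants.) *)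

theory Defs
  imports Complex_Main "HOL-Analysis.Finite_Cartesian_Product"
    "HOL-Library.Indicator_Function"
begin

text \<open>
  Multi-indices of dimension \<open>n\<close> are vectors of type \<open>nat ^ 'n\<close>, with \<open>n = CARD('n)\<close>
  and componentwise addition.
\<close>

definition mi_norm :: "nat ^ 'n \<Rightarrow> nat" where
  "mi_norm \<alpha> = (\<Sum>j\<in>UNIV. \<alpha> $ j)"

definition superlinear_norm :: "nat ^ 'n \<Rightarrow> nat" where
  "superlinear_norm \<alpha> = (\<Sum>j\<in>{j. \<alpha> $ j \<ge> 2}. \<alpha> $ j)"

definition m1 :: "nat ^ 'n \<Rightarrow> nat" where
  "m1 \<alpha> = card {j. \<alpha> $ j = 1}"

definition S :: "nat \<Rightarrow> (nat ^ 'n) set" where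
  "S r = {\<alpha>. superlinear_norm \<alpha> \<le> r}"

definition zero_one_indices :: "(nat ^ 'n) set" where
  "zero_one_indices = {\<epsilon>. \<forall>j. \<epsilon> $ j \<in> {0, 1}}"

text \<open>The coefficient is of interest only for \<open>\<alpha> \<in> S r\<close>; the formula is total.\<close>

definition interp_coeff :: "nat \<Rightarrow> nat ^ 'n \<Rightarrow> int" where
  "interp_coeff r \<alpha> =
     (\<Sum>\<epsilon>\<in>zero_one_indices. (-1) ^ mi_norm \<epsilon> * indicator (S r) (\<alpha> + \<epsilon>))"

text \<open>
  The lower argument is an integer, so that a negative value is not truncated to \<open>0\<close>.
  For \<open>j > l\<close> the library's binomial coefficient is already \<open>0\<close>.
\<close>

definition binom :: "nat \<Rightarrow> int \<Rightarrow> int" where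
  "binom l j = (if j < 0 then 0 else int (l choose nat j))"

text \<open>Meaningful for \<open>m < n\<close>, where the natural-number subtraction \<open>n - m - 1\<close> is exact.\<close>

definition c_formula :: "nat \<Rightarrow> nat \<Rightarrow> nat \<Rightarrow> int" where
  "c_formula n m k =
     (\<Sum>i = 0..m. (-1) ^ (k + i) * binom m (int i) * binom (n - m - 1) (int k - 2 * int i))"

end

theory Submission
  imports Defs
begin

text \<open>
  Identify \<open>\<epsilon>\<close> with its support. If \<open>a\<close> elements of the support lie in \<open>{j. \<alpha> $ j = 1}\<close> and
  \<open>b\<close> outside, then passing from \<open>\<alpha>\<close> to \<open>\<alpha> + \<epsilon>\<close> raises the superlinear norm by \<open>2 * a + b\<close>.
  Hence \<open>c\<^sub>\<alpha>\<close> is the sum of \<open>(-1) ^ (a + b) * (m choose a) * (n - m choose b)\<close> over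
  \<open>2 * a + b \<le> k\<close>, and the inner sum over \<open>b\<close> is a partial alternating row sum of Pascal's
  triangle, which collapses to a single binomial coefficient because \<open>n - m > 0\<close>.
\<close>

text \<open>Group the subsets by size. This is what turns sums over supports into sums with binomial
  weights.\<close>

lemma sum_Pow_card:
  fixes f :: "nat \<Rightarrow> 'b::comm_semiring_1"
  assumes "finite A"
  shows "(\<Sum>X\<in>Pow A. f (card X)) = (\<Sum>i\<le>card A. of_nat (card A choose i) * f i)"
proof -
  have "(\<Sum>X\<in>Pow A. f (card X)) = (\<Sum>i\<le>card A. \<Sum>X\<in>{X\<in>Pow A. card X = i}. f (card X))"
    using assms by (intro sum.group [symmetric]) (auto intro: card_mono)
  also have "\<dots> = (\<Sum>i\<le>card A. of_nat (card A choose i) * f i)"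
    using n_subsets [OF assms] by (intro sum.cong) simp_all
  finally show ?thesis .
qed

lemma sum_UNIV_Pow_split:
  fixes f :: "'a::finite set \<Rightarrow> 'b::comm_monoid_add"
  shows "(\<Sum>T\<in>UNIV. f T) = (\<Sum>A\<in>Pow M. \<Sum>B\<in>Pow (- M). f (A \<union> B))"
proof -
  have "(\<Sum>T\<in>UNIV. f T) = (\<Sum>(A, B)\<in>Pow M \<times> Pow (- M). f (A \<union> B))"
    by (rule sum.reindex_bij_witness
        [where i = "\<lambda>(A, B). A \<union> B" and j = "\<lambda>T. (T \<inter> M, T - M)"])
      (auto simp: Int_Diff_Un)
  then show ?thesis
    by (simp add: sum.cartesian_product)
qed

text \<open>By Pascal's rule the new term splits in two, and one part cancels the induction
  hypothesis. Row 0 has to be excluded: all its partial sums are 1.\<close>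

lemma alternating_partial_row_sum:
  "(\<Sum>j\<le>p. (-1) ^ j * int (Suc N choose j)) = (-1) ^ p * int (N choose p)"
  by (induction p) (auto simp: algebra_simps)

lemma alternating_row_sum_upto:
  assumes "N > 0"
  shows "(\<Sum>b\<le>N. int (N choose b) * ((-1) ^ b * of_bool (c + b \<le> k))) =
    (if c \<le> k then (-1) ^ (k - c) * int (N - 1 choose (k - c)) else 0)"
proof (cases "c \<le> k")
  case True
  have "(\<Sum>b\<le>N. int (N choose b) * ((-1) ^ b * of_bool (c + b \<le> k))) =
      (\<Sum>b\<le>k - c. (-1) ^ b * int (N choose b))"
    \<comment> \<open>Neither range need contain the other: \<open>of_bool\<close> kills the terms
      with \<open>b > k - c\<close>, the binomial coefficient those with
      \<open>b > N\<close>.\<close>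
    using True by (intro sum.mono_neutral_cong) auto
  with True alternating_partial_row_sum [of "N - 1" "k - c"] assms show ?thesis
    by simp
qed simp

definition char_vec :: "'n set \<Rightarrow> nat ^ 'n" where
  "char_vec T = (\<chi> j. if j \<in> T then 1 else 0)"

lemma mi_norm_char_vec: "mi_norm (char_vec T) = card T"
  by (simp add: mi_norm_def char_vec_def sum.If_cases)

lemma bij_betw_char_vec: "bij_betw char_vec UNIV (zero_one_indices :: (nat ^ 'n) set)"
  by (rule bij_betw_byWitness [where f' = "\<lambda>e. {j. e $ j = 1}"])
    (auto simp: char_vec_def zero_one_indices_def vec_eq_iff)

text \<open>An index in \<open>A\<close> turns an entry 1, invisible to the norm, into a visible 2;
  an index in \<open>B\<close> adds 1 to an entry that already counts. Positivity matters here: an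
  entry 0 would become 1 and still contribute nothing.\<close>

lemma superlinear_norm_add_char_vec:
  fixes \<alpha> :: "nat ^ 'n"
  assumes "\<forall>j. \<alpha> $ j \<ge> 1"
  defines "M \<equiv> {j. \<alpha> $ j = 1}"
  assumes "A \<subseteq> M" and "B \<subseteq> - M"
  shows "superlinear_norm (\<alpha> + char_vec (A \<union> B)) = superlinear_norm \<alpha> + (2 * card A + card B)"
proof -
  \<comment> \<open>The index set in the definition varies with the vector; summing over all indices
    allows an entrywise comparison.\<close>
  have norm: "superlinear_norm \<beta> = (\<Sum>j\<in>UNIV. if \<beta> $ j \<ge> 2 then \<beta> $ j else 0)"
    for \<beta> :: "nat ^ 'n"
    by (simp add: superlinear_norm_def sum.If_cases)
  have "superlinear_norm (\<alpha> + char_vec (A \<union> B)) =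
      (\<Sum>j\<in>UNIV. (if \<alpha> $ j \<ge> 2 then \<alpha> $ j else 0) +
        (2 * (if j \<in> A then 1 else 0) + (if j \<in> B then 1 else 0)))"
    unfolding norm
  proof (rule sum.cong)
    fix j
    have "\<alpha> $ j \<ge> 1"
      using assms by blast
    moreover have "j \<in> A \<Longrightarrow> \<alpha> $ j = 1" "j \<in> B \<Longrightarrow> \<alpha> $ j \<noteq> 1"
      using assms by (auto simp: M_def)
    ultimately show "(if (\<alpha> + char_vec (A \<union> B)) $ j \<ge> 2 then (\<alpha> + char_vec (A \<union> B)) $ j else 0) =
        (if \<alpha> $ j \<ge> 2 then \<alpha> $ j else 0) +
        (2 * (if j \<in> A then 1 else 0) + (if j \<in> B then 1 else 0))"
      by (auto simp: char_vec_def)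
  qed simp
  also have "\<dots> = superlinear_norm \<alpha> + (2 * card A + card B)"
    by (simp add: norm sum.distrib sum.If_cases flip: sum_distrib_left)
  finally show ?thesis .
qed

theorem theorem2:
  fixes \<alpha> :: "nat ^ 'n" and n r m k :: nat
  assumes "n = CARD('n)"
    and "r \<ge> 1"
    and "\<forall>j. \<alpha> $ j \<ge> 1"
    and "m = m1 \<alpha>"
    and "k \<in> {0..n + m - 1}"
    and "int (superlinear_norm \<alpha>) = int r - int k"
    and "m < n"
  shows "interp_coeff r \<alpha> = c_formula n m k"
proof -
  define M where "M = {j. \<alpha> $ j = 1}"
  have card_M: "card M = m"
    using assms(4) by (simp add: M_def m1_def)
  have card_compl: "card (- M) = n - m"
    using assms(1) card_M by (simp add: Compl_eq_Diff_UNIV card_Diff_subset)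
  \<comment> \<open>The summand depends on the support only through two cardinalities. As
    \<open>r\<close> is the norm of \<alpha> plus \<open>k\<close>, membership in \<open>S r\<close>
    becomes \<open>2 * a + b \<le> k\<close>.\<close>
  define g where "g a b = (-1) ^ (a + b) * (of_bool (2 * a + b \<le> k) :: int)" for a b
  have summand: "(-1) ^ mi_norm (char_vec (A \<union> B)) *
      indicator (S r) (\<alpha> + char_vec (A \<union> B)) = g (card A) (card B)"
    if "A \<subseteq> M" "B \<subseteq> - M" for A B
  proof -
    have "A \<inter> B = {}"
      using that by blast
    then have "card (A \<union> B) = card A + card B"
      by (simp add: card_Un_disjoint)
    moreover have "\<alpha> + char_vec (A \<union> B) \<in> S r \<longleftrightarrow> 2 * card A + card B \<le> k"
      using superlinear_norm_add_char_vec [OF assms(3), of A B] that assms(6)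
      by (auto simp: S_def M_def)
    ultimately show ?thesis
      by (simp add: g_def mi_norm_char_vec indicator_def)
  qed
  have "interp_coeff r \<alpha> = (\<Sum>T\<in>UNIV. (-1) ^ mi_norm (char_vec T :: nat ^ 'n) *
      indicator (S r) (\<alpha> + char_vec T))"
    unfolding interp_coeff_def by (rule sum.reindex_bij_betw [OF bij_betw_char_vec, symmetric])
  also have "\<dots> = (\<Sum>A\<in>Pow M. \<Sum>B\<in>Pow (- M). g (card A) (card B))"
    unfolding sum_UNIV_Pow_split [of _ M] by (intro sum.cong refl summand) auto
  \<comment> \<open>\<open>sum_Pow_card\<close> counts the choices of \<open>B\<close>, and then,
    with the resulting inner sum as \<open>f\<close>, those of \<open>A\<close>.\<close>
  also have "\<dots> = (\<Sum>a\<le>m. int (m choose a) * (\<Sum>b\<le>n - m. int (n - m choose b) * g a b))"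
    by (simp add: sum_Pow_card [where A = "- M"] card_compl
        sum_Pow_card [where A = M and f = "\<lambda>a. \<Sum>b\<le>n - m. int (n - m choose b) * g a b"] card_M)
  also have "\<dots> = c_formula n m k"
    unfolding c_formula_def atMost_atLeast0
  proof (intro sum.cong refl)
    fix a
    have "(\<Sum>b\<le>n - m. int (n - m choose b) * g a b) =
        (-1) ^ a * (\<Sum>b\<le>n - m. int (n - m choose b) * ((-1) ^ b * of_bool (2 * a + b \<le> k)))"
      by (simp add: g_def sum_distrib_left power_add mult_ac)
    also have "\<dots> = (-1) ^ a *
        (if 2 * a \<le> k then (-1) ^ (k - 2 * a) * int (n - m - 1 choose (k - 2 * a)) else 0)"
      using assms(7) by (subst alternating_row_sum_upto) auto
    \<comment> \<open>The exponents \<open>k - 2 * a\<close> and \<open>k\<close> have the same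
      parity. If \<open>2 * a > k\<close>, the lower argument of \<open>binom\<close> is negative
      and both sides vanish.\<close>
    also have "\<dots> = (-1) ^ (k + a) * binom (n - m - 1) (int k - 2 * int a)"
    proof (cases "2 * a \<le> k")
      case True
      then obtain q where "k = 2 * a + q"
        using le_Suc_ex by blast
      then show ?thesis
        by (simp add: binom_def power_add power_mult)
    qed (simp add: binom_def)
    finally show "int (m choose a) * (\<Sum>b = 0..n - m. int (n - m choose b) * g a b) =
        (-1) ^ (k + a) * binom m (int a) * binom (n - m - 1) (int k - 2 * int a)"
      by (simp add: binom_def atMost_atLeast0)
  qed
  finally show ?thesis .
qed

end
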